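(* Let $\mathcal Z=(\Pi,\Gamma)$ be a model, $s\in\mathbb R$, $T\in(0,1]$ and $\mathcal U\in\mathcal D^{\gamma_1,0}_{P_s,0}|_{O^s_{s+T}}$. Suppose that there exist $0<\delta_0\le T$ and a constant $\Lambda>0$ such that $$|\!|\!|\mathbf R_b^+\mathcal U|\!|\!|^{(b)}_{\gamma_1,0,O^b_c}\le\Lambda\qquad\text{for all } s\le b<c\le s+T\text{ with }c-b\le\delta_0 .$$ Then $$|\!|\!|\mathbf R_s^+\mathcal U|\!|\!|^{(s)}_{\gamma_1,0,O^s_{s+T}}\lesssim\Big(\frac1{\delta_0}\Big)^{\frac{\gamma_1+2}2}\big(\|\Gamma\|_{\overline{O^s_{s+T}}}\big)^2\,\Lambda .$$
   Context: **Basic notation.** Fix $d\ge1$, $\kappa\in(0,\frac13)$, $1+\kappa<\gamma_1<2-2\kappa$. $\mathbb T^d=(\mathbb R/2\pi\mathbb Z)^d$; "spatially periodic" means $2\pi\mathbb Z^d$-periodic in $x$. For $z=(t,x),w=(r,y)\in\mathbb R^{d+1}$, $d(z,w)=\max\{|t-r|^{1/2},\|x-y\|_{\mathbb T^d}\}$, where $\|\cdot\|_{\mathbb T^d}$ gives the distance on the torus. For a function $\chi$ on $\mathbb R^{d+1}$ and $l>0$, $\chi^l_z(r,y)=l^{-d-2}\chi((r-t)/l^2,(y-x)/l)$; $\mathcal B_0^2$ is the set of $C^2$ functions supported in the unit ball with $C^2$-norm $\le1$. $O^a_b=(a,b]\times\mathbb R^d$, $\overline{O^a_b}=[a,b]\times\mathbb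 R^d$. The symbol $\lesssim$ means inequality up to a multiplicative constant. **Regularity structure and models.** $\mathcal T$ is the real vector space with basis $\mathcal A=\{\Xi,\mathsf I\Xi,X_i\Xi,\mathbf 1,\mathsf I,X_i: 1\le i\le d\}$ and homogeneities $|\Xi|=-1-\kappa$, $|\mathsf I\Xi|=-2\kappa$, $|X_i\Xi|=-\kappa$, $|\mathbf 1|=0$, $|\mathsf I|=1-\kappa$, $|X_i|=1$; $\|\tau\|_a$ is the absolute value of the $a$-coefficient of $\tau$. A model $\mathcal Z=(\Pi,\Gamma)$ consists of linear $\Pi_z:\mathcal T\to\mathcal S'(\mathbb R^{d+1})$ and linear $\Gamma_{z,w}:\mathcal T\to\mathcal T$ with $\Pi_z\mathbf 1=1$, $\Pi_z(X_i)(w)=w_i-z_i$ (spatial coordinates), $\Pi_z(\mathsf I)=g-g(z)$ for a continuous function $g$, $\Gamma_{z,w}\Xi=\Xi$, $\Gamma_{z,w}\mathbf 1=\mathbf 1$, $\Gamma_{z,w}\tau=\tau-\Pi_z(\tau)(w)\mathbf 1$ and $\Gamma_{z,w}(\tau\Xi)=\tau\Xi-\Pi_z(\tau)(w)\Xi$ for $\tau\in\{\mathsf I,X_i\}$, $\Gamma_{z,w}\Gamma_{w,v}=\Gamma_{z,v}$, $\Pi_z\Gamma_{z,w}=\Pi_w$, everything invariant under simultaneous spatial translation by $2\pi\mathbb Z^d$, and with finite seminorms $\max_a\sup_{\chi\in\mathcal B_0^2,0<l\le1,z\in\mathcal O}l^{-|a|}|\langle\Pi_za,\chi_z^l\rangle|$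 and $\|\Gamma\|_{\mathcal O}=1+\max_{|a_1|<|a_2|}\sup_{z\ne w\in\mathcal O}\|\Gamma_{z,w}a_2\|_{a_1}d(z,w)^{|a_1|-|a_2|}$. **Modelled distributions.** $P_s=\{s\}\times\mathbb R^d$, $\|z\|_{P_s}=\min\{1,|t-s|^{1/2}\}$, $\|z,w\|_{P_s}=\min\{\|z\|_{P_s},\|w\|_{P_s}\}$. For spatially periodic $F=\sum_aF^aa$ with values in $\mathrm{span}\{a:|a|<\gamma\}$, $$|\!|\!|F|\!|\!|^{(s)}_{\gamma,\eta,D}=\sup_{|a|<\gamma}\ \sup_{z\ne w\in D,\,d(z,w)\le\|z,w\|_{P_s}}\frac{\|z,w\|_{P_s}^{\gamma-\eta}\|F(z)-\Gamma_{z,w}F(w)\|_a}{d(z,w)^{\gamma-|a|}}+\sup_{|a|<\gamma}\sup_{z\in D}\|z\|_{P_s}^{\max\{0,|a|-\eta\}}\|F(z)\|_a.$$ $\mathcal D^{\gamma_1,0}_{P_s,0}|_{O^s_{s+T}}$ is the space of spatially periodic $F:O^s_{s+T}\to\mathrm{span}\{\mathbf 1,\mathsf I,X_i:1\le i\le d\}$ with $|\!|\!|F|\!|\!|^{(s)}_{\gamma_1,0,O^s_{s+T}}<\infty$. $\mathbf R_b^+$ is multiplication by $\mathbf 1_{\{t>b\}}$.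
   Formalization: The two-point suprema in ‖Γ‖ and in the modelled-distribution norm range only over pairs z≠w with |x−y| equal to the torus distance; over all pairs in R^{d+1}, ‖Γ‖ would be infinite on every strip because of Γ_{z,w}X_i, so no model would exist. *)

theory Defs
  imports "HOL-Analysis.Analysis"
begin

section \<open>Space-time\<close>

type_synonym 'n spacetime = "real \<times> (real ^ 'n)"

definition lattice_vec :: "int ^ 'n::finite \<Rightarrow> real ^ 'n" where
  "lattice_vec k = (\<chi> i. 2 * pi * of_int (k $ i))"

definition shift :: "int ^ 'n::finite \<Rightarrow> 'n spacetime \<Rightarrow> 'n spacetime" where
  "shift k z = (fst z, snd z + lattice_vec k)"

definition torus_norm :: "real ^ 'n::finite \<Rightarrow> real" where
  "torus_norm x = (INF k. norm (x + lattice_vec k))"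

definition pdist :: "'n::finite spacetime \<Rightarrow> 'n spacetime \<Rightarrow> real" where
  "pdist z w = max (sqrt \<bar>fst z - fst w\<bar>) (torus_norm (snd z - snd w))"

text \<open>
  The reexpansion maps and the monomials $X_i$ live on the full space and are only jointly periodic:
  the unit coefficient of $\Gamma_{z,w} X_i$ is $z_i - w_i$, which does not become small when $w$
  approaches a nontrivial lattice translate of $z$, whereas \<^term>\<open>pdist z w\<close> does. A supremum over
  all pairs of points, weighted by negative powers of \<^term>\<open>pdist\<close>, would hence be infinite for every
  model. As usual, a pair of points of the torus is therefore represented by lifts realising the
  torus distance, and the two-point suprema below range over such pairs.
\<close>

definition nearest_lifts :: "'n::finite spacetime \<Rightarrow> 'n spacetime \<Rightarrow> bool" where
  "nearest_lifts z w \<longleftrightarrow> norm (snd z - snd w) = torus_norm (snd z - snd w)"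

definition strip :: "real \<Rightarrow> real \<Rightarrow> ('n::finite spacetime) set" where
  "strip a b = {a<..b} \<times> UNIV"

definition closed_strip :: "real \<Rightarrow> real \<Rightarrow> ('n::finite spacetime) set" where
  "closed_strip a b = {a..b} \<times> UNIV"


section \<open>Test functions and tempered distributions\<close>

text \<open>Iterated partial derivatives; a multi-index is given as a list of basis vectors.\<close>

fun partials :: "'a list \<Rightarrow> ('a::euclidean_space \<Rightarrow> real) \<Rightarrow> 'a \<Rightarrow> real" where
  "partials [] f = f"
| "partials (v # vs) f = (\<lambda>z. frechet_derivative (partials vs f) (at z) v)"

definition multi_indices :: "nat \<Rightarrow> ('a::euclidean_space list) set" where
  "multi_indices k = {vs \<in> lists Basis. length vs \<le> k}"

definition C_diff :: "nat \<Rightarrow> ('a::euclidean_space \<Rightarrow> real) set" where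
  "C_diff k = {f. (\<forall>vs\<in>multi_indices k. continuous_on UNIV (partials vs f) \<and>
                     (length vs < k \<longrightarrow> partials vs f differentiable_on UNIV))}"

definition schwartz :: "('a::euclidean_space \<Rightarrow> real) set" where
  "schwartz = {f. (\<forall>k. f \<in> C_diff k) \<and>
     (\<forall>N. \<forall>vs\<in>lists Basis. bounded (range (\<lambda>z. (1 + norm z) ^ N * partials vs f z)))}"

definition schwartz_norm :: "nat \<Rightarrow> ('a::euclidean_space \<Rightarrow> real) \<Rightarrow> real" where
  "schwartz_norm N f = (SUP (vs, z) \<in> multi_indices N \<times> UNIV. (1 + norm z) ^ N * \<bar>partials vs f z\<bar>)"

text \<open>A distribution is a functional on all functions of which only the values on
  \<^term>\<open>schwartz\<close> matter.\<close>

definition tempered_distribution :: "(('a::euclidean_space \<Rightarrow> real) \<Rightarrow> real) \<Rightarrow> bool" where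
  "tempered_distribution S \<longleftrightarrow>
     (\<forall>f\<in>schwartz. \<forall>h\<in>schwartz. \<forall>c d. S (\<lambda>z. c * f z + d * h z) = c * S f + d * S h) \<and>
     (\<exists>C N. \<forall>f\<in>schwartz. \<bar>S f\<bar> \<le> C * schwartz_norm N f)"

definition test_functions :: "('a::euclidean_space \<Rightarrow> real) set" where
  "test_functions = {f. (\<forall>k. f \<in> C_diff k) \<and> bounded {z. f z \<noteq> 0}}"

text \<open>Equality of a distribution with a continuous function needs to be tested against smooth
  compactly supported functions only, since these are dense in \<^term>\<open>schwartz\<close>.\<close>

definition is_function :: "(('a::euclidean_space \<Rightarrow> real) \<Rightarrow> real) \<Rightarrow> ('a \<Rightarrow> real) \<Rightarrow> bool" where
  "is_function S f \<longleftrightarrow> (\<forall>\<phi>\<in>test_functions. S \<phi> = (LINT w|lborel. f w * \<phi> w))"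

text \<open>
  The functions tested against below are only $C^2$. The pairing with them is the unique extension
  of the distribution that is continuous with respect to $C^2$-convergence with uniformly bounded
  supports; \<open>C2_extendable\<close> says that this extension exists.
\<close>

definition C2_tendsto :: "(nat \<Rightarrow> 'a::euclidean_space \<Rightarrow> real) \<Rightarrow> ('a \<Rightarrow> real) \<Rightarrow> bool" where
  "C2_tendsto f h \<longleftrightarrow> bounded (\<Union>n. {z. f n z \<noteq> 0}) \<and>
     (\<forall>vs\<in>multi_indices 2. uniform_limit UNIV (\<lambda>n. partials vs (f n)) (partials vs h) sequentially)"

definition pairs_to :: "(('a::euclidean_space \<Rightarrow> real) \<Rightarrow> real) \<Rightarrow> ('a \<Rightarrow> real) \<Rightarrow> real \<Rightarrow> bool" where
  "pairs_to S \<psi> c \<longleftrightarrow>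
     (\<forall>f. range f \<subseteq> test_functions \<and> C2_tendsto f \<psi> \<longrightarrow> (\<lambda>n. S (f n)) \<longlonglongrightarrow> c)"

definition C2_extendable :: "(('a::euclidean_space \<Rightarrow> real) \<Rightarrow> real) \<Rightarrow> bool" where
  "C2_extendable S \<longleftrightarrow>
     (\<forall>\<psi>\<in>C_diff 2. bounded {z. \<psi> z \<noteq> 0} \<longrightarrow> (\<exists>c. pairs_to S \<psi> c))"

definition pairing :: "(('a::euclidean_space \<Rightarrow> real) \<Rightarrow> real) \<Rightarrow> ('a \<Rightarrow> real) \<Rightarrow> real" where
  "pairing S \<psi> = (THE c. pairs_to S \<psi> c)"

definition B20 :: "('a::euclidean_space \<Rightarrow> real) set" where
  "B20 = {\<psi> \<in> C_diff 2. {z. \<psi> z \<noteq> 0} \<subseteq> cball 0 1 \<and>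
            (\<forall>vs\<in>multi_indices 2. \<forall>z. \<bar>partials vs \<psi> z\<bar> \<le> 1)}"

definition rescale ::
    "('n spacetime \<Rightarrow> real) \<Rightarrow> real \<Rightarrow> 'n::finite spacetime \<Rightarrow> 'n spacetime \<Rightarrow> real" where
  "rescale \<psi> l z w =
     \<psi> ((fst w - fst z) / l\<^sup>2, (snd w - snd z) /\<^sub>R l) / l ^ (CARD('n) + 2)"


section \<open>Regularity structure and models\<close>

text \<open>The symbols $\Xi$, $\mathsf I\Xi$, $X_i\Xi$, $\mathbf 1$, $\mathsf I$, $X_i$.\<close>

datatype 'n symbol = Noise | INoise | XNoise 'n | Unit | Integ | X 'n

instance symbol :: (finite) finite
proof
  have "(UNIV :: 'a symbol set) \<subseteq> {Noise, INoise, Unit, Integ} \<union> range XNoise \<union> range X"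
  proof
    fix a :: "'a symbol"
    show "a \<in> {Noise, INoise, Unit, Integ} \<union> range XNoise \<union> range X"
      by (cases a) auto
  qed
  then show "finite (UNIV :: 'a symbol set)"
    by (rule finite_subset) simp
qed

type_synonym 'n tspace = "(real, 'n symbol) vec"

abbreviation sym :: "'n::finite symbol \<Rightarrow> 'n tspace" where
  "sym a \<equiv> axis a 1"

primrec hom :: "real \<Rightarrow> 'n symbol \<Rightarrow> real" where
  "hom \<kappa> Noise = - 1 - \<kappa>"
| "hom \<kappa> INoise = - 2 * \<kappa>"
| "hom \<kappa> (XNoise i) = - \<kappa>"
| "hom \<kappa> Unit = 0"
| "hom \<kappa> Integ = 1 - \<kappa>"
| "hom \<kappa> (X i) = 1"

type_synonym 'n pimap = "'n spacetime \<Rightarrow> 'n tspace \<Rightarrow> ('n spacetime \<Rightarrow> real) \<Rightarrow> real"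
type_synonym 'n gammamap = "'n spacetime \<Rightarrow> 'n spacetime \<Rightarrow> 'n tspace \<Rightarrow> 'n tspace"

definition Pi_norm :: "real \<Rightarrow> 'n::finite pimap \<Rightarrow> ('n spacetime) set \<Rightarrow> ennreal" where
  "Pi_norm \<kappa> \<P> D =
     (SUP a. SUP (\<psi>, l, z) \<in> B20 \<times> {0<..1} \<times> D.
        ennreal (l powr (- hom \<kappa> a) * \<bar>pairing (\<P> z (sym a)) (rescale \<psi> l z)\<bar>))"

definition Gamma_norm :: "real \<Rightarrow> 'n::finite gammamap \<Rightarrow> ('n spacetime) set \<Rightarrow> ennreal" where
  "Gamma_norm \<kappa> \<Gamma> D =
     1 + (SUP (a1, a2) \<in> {(a1, a2). hom \<kappa> a1 < hom \<kappa> a2}.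
          SUP (z, w) \<in> {(z, w). z \<in> D \<and> w \<in> D \<and> z \<noteq> w \<and> nearest_lifts z w}.
            ennreal (\<bar>\<Gamma> z w (sym a2) $ a1\<bar> * pdist z w powr (hom \<kappa> a1 - hom \<kappa> a2)))"

text \<open>The function \<open>g\<close> determines $\Pi_z \mathsf I = g - g(z)$. The seminorms have to be finite
  locally in time and, by periodicity, globally in space.\<close>

definition is_model :: "real \<Rightarrow> 'n::finite pimap \<Rightarrow> 'n gammamap \<Rightarrow> bool" where
  "is_model \<kappa> \<P> \<Gamma> \<longleftrightarrow>
     (\<forall>z \<tau>. tempered_distribution (\<P> z \<tau>) \<and> C2_extendable (\<P> z \<tau>)) \<and>
     (\<forall>z. \<forall>\<phi>\<in>schwartz. linear (\<lambda>\<tau>. \<P> z \<tau> \<phi>)) \<and>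
     (\<forall>z w. linear (\<Gamma> z w)) \<and>
     (\<forall>z. is_function (\<P> z (sym Unit)) (\<lambda>w. 1)) \<and>
     (\<forall>z i. is_function (\<P> z (sym (X i))) (\<lambda>w. snd w $ i - snd z $ i)) \<and>
     (\<exists>g. continuous_on UNIV g \<and>
          (\<forall>z. is_function (\<P> z (sym Integ)) (\<lambda>w. g w - g z)) \<and>
          (\<forall>z w. \<Gamma> z w (sym Integ) = sym Integ - (g w - g z) *\<^sub>R sym Unit \<and>
                 \<Gamma> z w (sym INoise) = sym INoise - (g w - g z) *\<^sub>R sym Noise)) \<and>
     (\<forall>z w. \<Gamma> z w (sym Noise) = sym Noise) \<and>
     (\<forall>z w. \<Gamma> z w (sym Unit) = sym Unit) \<and>
     (\<forall>z w i. \<Gamma> z w (sym (X i)) = sym (X i) - (snd w $ i - snd z $ i) *\<^sub>R sym Unit \<and>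
              \<Gamma> z w (sym (XNoise i)) = sym (XNoise i) - (snd w $ i - snd z $ i) *\<^sub>R sym Noise) \<and>
     (\<forall>z w v. \<Gamma> z w \<circ> \<Gamma> w v = \<Gamma> z v) \<and>
     (\<forall>z w \<tau>. \<forall>\<phi>\<in>schwartz. \<P> z (\<Gamma> z w \<tau>) \<phi> = \<P> w \<tau> \<phi>) \<and>
     (\<forall>k z \<tau>. \<forall>\<phi>\<in>schwartz. \<P> (shift k z) \<tau> \<phi> = \<P> z \<tau> (\<lambda>w. \<phi> (shift k w))) \<and>
     (\<forall>k z w. \<Gamma> (shift k z) (shift k w) = \<Gamma> z w) \<and>
     (\<forall>a b. Pi_norm \<kappa> \<P> (closed_strip a b) < \<infinity> \<and> Gamma_norm \<kappa> \<Gamma> (closed_strip a b) < \<infinity>)"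


section \<open>Modelled distributions\<close>

definition Pdist :: "real \<Rightarrow> 'n::finite spacetime \<Rightarrow> real" where
  "Pdist s z = min 1 (sqrt \<bar>fst z - s\<bar>)"

definition Pdist2 :: "real \<Rightarrow> 'n::finite spacetime \<Rightarrow> 'n spacetime \<Rightarrow> real" where
  "Pdist2 s z w = min (Pdist s z) (Pdist s w)"

text \<open>To be used for sets \<open>D\<close> that do not meet the time-\<open>s\<close> hyperplane, so that all bases
  of powers are positive.\<close>

definition md_norm :: "real \<Rightarrow> 'n::finite gammamap \<Rightarrow> real \<Rightarrow> real \<Rightarrow> real \<Rightarrow>
    ('n spacetime) set \<Rightarrow> ('n spacetime \<Rightarrow> 'n tspace) \<Rightarrow> ennreal" where
  "md_norm \<kappa> \<Gamma> \<gamma> \<eta> s D F =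
     (SUP a \<in> {a. hom \<kappa> a < \<gamma>}.
      SUP (z, w) \<in> {(z, w). z \<in> D \<and> w \<in> D \<and> z \<noteq> w \<and> nearest_lifts z w \<and> pdist z w \<le> Pdist2 s z w}.
        ennreal (Pdist2 s z w powr (\<gamma> - \<eta>) * \<bar>(F z - \<Gamma> z w (F w)) $ a\<bar> / pdist z w powr (\<gamma> - hom \<kappa> a)))
   + (SUP a \<in> {a. hom \<kappa> a < \<gamma>}. SUP z \<in> D.
        ennreal (Pdist s z powr (max 0 (hom \<kappa> a - \<eta>)) * \<bar>F z $ a\<bar>))"

definition spatially_periodic_on :: "('n::finite spacetime) set \<Rightarrow> ('n spacetime \<Rightarrow> 'b) \<Rightarrow> bool" where
  "spatially_periodic_on D F \<longleftrightarrow> (\<forall>z\<in>D. \<forall>k. F (shift k z) = F z)"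

text \<open>Elements are functions on space-time; only their values on the strip are constrained.\<close>

definition modelled_distributions :: "real \<Rightarrow> 'n::finite gammamap \<Rightarrow> real \<Rightarrow> real \<Rightarrow> real \<Rightarrow>
    ('n spacetime \<Rightarrow> 'n tspace) set" where
  "modelled_distributions \<kappa> \<Gamma> \<gamma> s T =
     {F. spatially_periodic_on (strip s (s + T)) F \<and>
         (\<forall>z \<in> strip s (s + T). F z \<in> span ({sym Unit, sym Integ} \<union> range (\<lambda>i. sym (X i)))) \<and>
         md_norm \<kappa> \<Gamma> \<gamma> 0 s (strip s (s + T)) F < \<infinity>}"

definition Rplus :: "real \<Rightarrow> ('n::finite spacetime \<Rightarrow> 'n tspace) \<Rightarrow> 'n spacetime \<Rightarrow> 'n tspace" where
  "Rplus b F z = indicator {b<..} (fst z) *\<^sub>R F z"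

end

theory Submission
  imports Defs
begin

text \<open>
  No chaining of short time steps is needed. Two points whose distance is at most
  $\sqrt{\delta_0/2}$ both lie in a window of length $\delta_0$ that either starts at $s$ or starts at
  distance at least $\sqrt{\delta_0/2}$ from both of them, so the local bound applies directly. For
  two points further apart the weight \<open>pdist\<close> is bounded below by a power of $\delta_0$,
  and the pointwise bounds together with the triangle inequality suffice; this uses $\Gamma$ only once.
\<close>

section \<open>Homogeneities and single terms of the suprema in \<open>md_norm\<close>\<close>

lemma hom_bounds:
  assumes "0 < \<kappa>" "\<kappa> < 1"
  shows "- 2 < hom \<kappa> a" "hom \<kappa> a \<le> 1"
  using assms by (cases a; simp)+

lemma md_norm_point_le:
  assumes "md_norm \<kappa> \<Gamma> \<gamma> \<eta> s D F \<le> ennreal \<Lambda>" "0 \<le> \<Lambda>" "hom \<kappa> a < \<gamma>" "z \<in> D"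
  shows "Pdist s z powr (max 0 (hom \<kappa> a - \<eta>)) * \<bar>F z $ a\<bar> \<le> \<Lambda>"
proof -
  have "ennreal (Pdist s z powr (max 0 (hom \<kappa> a - \<eta>)) * \<bar>F z $ a\<bar>) \<le>
      (SUP a \<in> {a. hom \<kappa> a < \<gamma>}. SUP z \<in> D.
        ennreal (Pdist s z powr (max 0 (hom \<kappa> a - \<eta>)) * \<bar>F z $ a\<bar>))"
    using assms(3,4) by (intro SUP_upper2[of a] SUP_upper2[of z]) auto
  also have "\<dots> \<le> md_norm \<kappa> \<Gamma> \<gamma> \<eta> s D F"
    unfolding md_norm_def by (rule add_increasing) auto
  finally show ?thesis
    using assms(1,2) by (metis ennreal_le_iff order_trans)
qed

text \<open>The weight is bracketed apart from the quotient, so that later estimates can exchange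
  the weight for a cruder bound while the quotient stays fixed.\<close>

lemma md_norm_two_point_le:
  assumes "md_norm \<kappa> \<Gamma> \<gamma> \<eta> s D F \<le> ennreal \<Lambda>" "0 \<le> \<Lambda>" "hom \<kappa> a < \<gamma>"
    and "z \<in> D" "w \<in> D" "z \<noteq> w" "nearest_lifts z w" "pdist z w \<le> Pdist2 s z w"
  shows "Pdist2 s z w powr (\<gamma> - \<eta>) *
    (\<bar>(F z - \<Gamma> z w (F w)) $ a\<bar> / pdist z w powr (\<gamma> - hom \<kappa> a)) \<le> \<Lambda>"
proof -
  have "ennreal (Pdist2 s z w powr (\<gamma> - \<eta>) * \<bar>(F z - \<Gamma> z w (F w)) $ a\<bar>
        / pdist z w powr (\<gamma> - hom \<kappa> a)) \<le>
      (SUP a \<in> {a. hom \<kappa> a < \<gamma>}.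
      SUP (z, w) \<in> {(z, w). z \<in> D \<and> w \<in> D \<and> z \<noteq> w \<and> nearest_lifts z w \<and> pdist z w \<le> Pdist2 s z w}.
        ennreal (Pdist2 s z w powr (\<gamma> - \<eta>) * \<bar>(F z - \<Gamma> z w (F w)) $ a\<bar>
          / pdist z w powr (\<gamma> - hom \<kappa> a)))"
    using assms(3-) by (intro SUP_upper2[of a] SUP_upper2[of "(z, w)"]) auto
  also have "\<dots> \<le> md_norm \<kappa> \<Gamma> \<gamma> \<eta> s D F"
    unfolding md_norm_def by (rule add_increasing2) auto
  finally have "ennreal (Pdist2 s z w powr (\<gamma> - \<eta>) * \<bar>(F z - \<Gamma> z w (F w)) $ a\<bar>
      / pdist z w powr (\<gamma> - hom \<kappa> a)) \<le> ennreal \<Lambda>"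
    using assms(1) by (rule order_trans)
  then show ?thesis
    using assms(2) by (simp add: ennreal_le_iff)
qed

lemma md_norm_leI:
  assumes "0 \<le> A" "0 \<le> B"
    and "\<And>a z w. hom \<kappa> a < \<gamma> \<Longrightarrow> z \<in> D \<Longrightarrow> w \<in> D \<Longrightarrow> z \<noteq> w \<Longrightarrow> nearest_lifts z w \<Longrightarrow>
      pdist z w \<le> Pdist2 s z w \<Longrightarrow> Pdist2 s z w powr (\<gamma> - \<eta>) *
      (\<bar>(F z - \<Gamma> z w (F w)) $ a\<bar> / pdist z w powr (\<gamma> - hom \<kappa> a)) \<le> A"
    and "\<And>a z. hom \<kappa> a < \<gamma> \<Longrightarrow> z \<in> D \<Longrightarrow>
      Pdist s z powr (max 0 (hom \<kappa> a - \<eta>)) * \<bar>F z $ a\<bar> \<le> B"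
  shows "md_norm \<kappa> \<Gamma> \<gamma> \<eta> s D F \<le> ennreal (A + B)"
  unfolding md_norm_def ennreal_plus[OF assms(1,2)]
proof (intro add_mono SUP_least)
  fix a :: "'a symbol" and zw :: "'a spacetime \<times> 'a spacetime"
  assume "a \<in> {a. hom \<kappa> a < \<gamma>}"
    and "zw \<in> {(z, w). z \<in> D \<and> w \<in> D \<and> z \<noteq> w \<and> nearest_lifts z w \<and> pdist z w \<le> Pdist2 s z w}"
  then show "(case zw of (z, w) \<Rightarrow> ennreal (Pdist2 s z w powr (\<gamma> - \<eta>) *
      \<bar>(F z - \<Gamma> z w (F w)) $ a\<bar> / pdist z w powr (\<gamma> - hom \<kappa> a))) \<le> ennreal A"
    using assms(3)[of a "fst zw" "snd zw"] by (auto simp: case_prod_unfold intro!: ennreal_leI)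
qed (use assms(4) in \<open>auto intro!: ennreal_leI\<close>)

section \<open>Matrix entries of the reexpansion maps\<close>

lemma model_Gamma_triangular:
  assumes "is_model \<kappa> \<P> \<Gamma>" "0 < \<kappa>" "\<kappa> < 1" "\<Gamma> z w (sym b) $ a \<noteq> 0"
  shows "a = b \<and> \<Gamma> z w (sym b) $ a = 1 \<or> hom \<kappa> a < hom \<kappa> b"
proof -
  obtain g where
    "\<And>z w. \<Gamma> z w (sym Integ) = sym Integ - (g w - g z) *\<^sub>R sym Unit"
    "\<And>z w. \<Gamma> z w (sym INoise) = sym INoise - (g w - g z) *\<^sub>R sym Noise"
    using assms(1) unfolding is_model_def by metis
  moreover have "\<Gamma> z w (sym Noise) = sym Noise" "\<Gamma> z w (sym Unit) = sym Unit"
    "\<Gamma> z w (sym (X i)) = sym (X i) - (snd w $ i - snd z $ i) *\<^sub>R sym Unit"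
    "\<Gamma> z w (sym (XNoise i)) = sym (XNoise i) - (snd w $ i - snd z $ i) *\<^sub>R sym Noise" for i
    using assms(1) unfolding is_model_def by metis+
  \<comment> \<open>Only multiples of \<open>Unit\<close> or \<open>Noise\<close> are ever
    subtracted. The bound \<open>\<kappa> < 1\<close> places \<open>Unit\<close> below
    \<open>Integ\<close> and \<open>Noise\<close> below \<open>INoise\<close>.\<close>
  ultimately show ?thesis
    using assms(2-) by (cases b) (auto simp: axis_def split: if_splits)
qed

text \<open>\<open>Gamma_norm\<close> sees only entries that strictly lower the homogeneity. By
  triangularity the remaining entries vanish or are diagonal entries 1, for which the exponent is 0
  and \<open>1 \<le> G\<close> suffices. One bound thus serves every term of an expansion in the
  symbols.\<close>

lemma model_Gamma_le:
  assumes "is_model \<kappa> \<P> \<Gamma>" "0 < \<kappa>" "\<kappa> < 1" "Gamma_norm \<kappa> \<Gamma> D = ennreal G" "1 \<le> G"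
    and "z \<in> D" "w \<in> D" "z \<noteq> w" "nearest_lifts z w" "0 < pdist z w"
  shows "\<bar>\<Gamma> z w (sym b) $ a\<bar> \<le> G * pdist z w powr (hom \<kappa> b - hom \<kappa> a)"
proof (cases "\<Gamma> z w (sym b) $ a = 0")
  case True
  then show ?thesis using assms(5) by simp
next
  case False
  from model_Gamma_triangular[OF assms(1-3) False] show ?thesis
  proof
    assume "a = b \<and> \<Gamma> z w (sym b) $ a = 1"
    then have "a = b" "\<Gamma> z w (sym b) $ b = 1"
      by auto
    then show ?thesis using assms(5,10) by simp
  next
    assume ab: "hom \<kappa> a < hom \<kappa> b"
    have "ennreal (\<bar>\<Gamma> z w (sym b) $ a\<bar> * pdist z w powr (hom \<kappa> a - hom \<kappa> b)) \<le>
      (SUP (a1, a2) \<in> {(a1, a2). hom \<kappa> a1 < hom \<kappa> a2}.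
          SUP (z, w) \<in> {(z, w). z \<in> D \<and> w \<in> D \<and> z \<noteq> w \<and> nearest_lifts z w}.
            ennreal (\<bar>\<Gamma> z w (sym a2) $ a1\<bar> * pdist z w powr (hom \<kappa> a1 - hom \<kappa> a2)))"
      using assms(6-9) ab by (intro SUP_upper2[of "(a, b)"]) (auto intro: SUP_upper2[of "(z, w)"])
    also have "\<dots> \<le> Gamma_norm \<kappa> \<Gamma> D"
      unfolding Gamma_norm_def by (rule add_increasing) auto
    finally have "\<bar>\<Gamma> z w (sym b) $ a\<bar> * pdist z w powr (hom \<kappa> a - hom \<kappa> b) \<le> G"
      using assms(4,5) by (simp add: ennreal_le_iff)
    then have "\<bar>\<Gamma> z w (sym b) $ a\<bar> * pdist z w powr (hom \<kappa> a - hom \<kappa> b)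
        * pdist z w powr (hom \<kappa> b - hom \<kappa> a) \<le> G * pdist z w powr (hom \<kappa> b - hom \<kappa> a)"
      by (rule mult_right_mono) simp
    then show ?thesis
      using assms(10) by (simp add: mult.assoc flip: powr_add)
  qed
qed

lemma model_Gamma_component:
  assumes "is_model \<kappa> \<P> \<Gamma>"
  shows "\<Gamma> z w \<tau> $ a = (\<Sum>b\<in>UNIV. \<tau> $ b * \<Gamma> z w (sym b) $ a)"
proof -
  have lin: "linear (\<Gamma> z w)"
    using assms unfolding is_model_def by metis
  have "\<Gamma> z w \<tau> = \<Gamma> z w (\<Sum>b\<in>UNIV. (\<tau> $ b) *\<^sub>R sym b)"
    by (simp add: basis_expansion flip: scalar_mult_eq_scaleR)
  then show ?thesis
    by (simp add: linear_sum[OF lin] linear_scale[OF lin])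
qed

section \<open>Comparison of negative powers\<close>

lemma powr_neg_le_powr_neg:
  fixes e d p q :: real
  assumes "0 < e" "e \<le> 1" "e \<le> d" "0 \<le> p" "p \<le> q"
  shows "d powr (- p) \<le> e powr (- q)"
proof -
  have "d powr (- p) \<le> e powr (- p)"
    using assms by (intro powr_mono2') auto
  also have "\<dots> \<le> e powr (- q)"
    using assms by (intro powr_mono') auto
  finally show ?thesis .
qed

text \<open>The factor \<open>e powr (- q)\<close> is at least 1. Bounds by \<Lambda> alone are
  thereby brought to the same form as those that lose a power of \<delta>.\<close>

lemma le_mult_powr_neg:
  fixes e q x y :: real
  assumes "0 < e" "e \<le> 1" "0 \<le> q" "x \<le> y" "0 \<le> y"
  shows "x \<le> y * e powr (- q)"
proof -
  have "1 \<le> e powr (- q)"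
    using powr_neg_le_powr_neg[of e 1 0 q] assms by simp
  then have "y * 1 \<le> y * e powr (- q)"
    using assms(5) by (intro mult_left_mono)
  then show ?thesis using assms(4) by simp
qed

section \<open>Pointwise bounds from short windows\<close>

context
  fixes \<kappa> \<gamma> :: real and \<Gamma> :: "'n::finite gammamap" and s T \<delta> \<Lambda> :: real
    and U :: "'n spacetime \<Rightarrow> 'n tspace"
  assumes \<kappa>: "0 < \<kappa>" "\<kappa> < 1" and \<gamma>: "1 < \<gamma>" and \<delta>: "0 < \<delta>" "\<delta> \<le> T" "T \<le> 1" and \<Lambda>: "0 < \<Lambda>"
    and local_bound: "\<And>b c. s \<le> b \<Longrightarrow> b < c \<Longrightarrow> c \<le> s + T \<Longrightarrow> c - b \<le> \<delta> \<Longrightarrow>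
        md_norm \<kappa> \<Gamma> \<gamma> 0 b (strip b c) (Rplus b U) \<le> ennreal \<Lambda>"
begin

text \<open>The two suprema in \<open>md_norm\<close> therefore control every component, and
  \<open>hom \<kappa> b - \<gamma>\<close> is always a negative exponent.\<close>

lemma hom_less: "hom \<kappa> a < \<gamma>"
  using hom_bounds(2)[OF \<kappa>, of a] \<gamma> by linarith

text \<open>The window ends exactly at the time of \<open>z\<close>, which it contains because
  strips are closed on the right; on it \<open>Rplus b U\<close> agrees with
  \<open>U\<close>.\<close>

lemma window_point_le:
  assumes "s \<le> b" "b < fst z" "fst z \<le> s + T" "fst z - b \<le> \<delta>"
  shows "Pdist b z powr (max 0 (hom \<kappa> a)) * \<bar>U z $ a\<bar> \<le> \<Lambda>"
  using md_norm_point_le[OF local_bound[OF assms], of a z] \<Lambda> hom_less assms(2)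
  by (cases z) (auto simp: strip_def Rplus_def)

text \<open>The window ends at the later of the two times. The last premise is measured from the
  start \<open>b\<close> of the window, so it has to be verified anew whenever \<open>b\<close>
  differs from \<open>s\<close>.\<close>

lemma window_two_point_le:
  assumes "s \<le> b" "b < fst z" "b < fst w" "max (fst z) (fst w) \<le> s + T"
    and "max (fst z) (fst w) - b \<le> \<delta>" "z \<noteq> w" "nearest_lifts z w" "pdist z w \<le> Pdist2 b z w"
  shows "Pdist2 b z w powr \<gamma> *
    (\<bar>(U z - \<Gamma> z w (U w)) $ a\<bar> / pdist z w powr (\<gamma> - hom \<kappa> a)) \<le> \<Lambda>"
proof -
  have "b < max (fst z) (fst w)"
    using assms(2) by simp
  from md_norm_two_point_le[OF local_bound[OF assms(1) this assms(4,5)], of a z w]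
  show ?thesis
    using \<Lambda> hom_less assms by (cases z; cases w) (auto simp: strip_def Rplus_def)
qed

text \<open>The weight in the window bound can be divided out, because \<open>z\<close> keeps time
  distance at least \<open>e\<close> from the start of its window.\<close>

lemma component_le:
  assumes "z \<in> strip s (s + T)" "0 < e" "e \<le> \<delta>" "e \<le> fst z - s"
  shows "\<bar>U z $ a\<bar> \<le> \<Lambda> * sqrt e powr (- max 0 (hom \<kappa> a))"
proof -
  \<comment> \<open>The earliest admissible start of a window ending at \<open>z\<close>; the time
    elapsed since then is the minimum of \<delta> and \<open>fst z - s\<close>.\<close>
  define b where "b = max s (fst z - \<delta>)"
  have z: "s < fst z" "fst z \<le> s + T"
    using assms(1) by (auto simp: strip_def)
  have "Pdist b z powr (max 0 (hom \<kappa> a)) * \<bar>U z $ a\<bar> \<le> \<Lambda>"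
    using z \<delta>(1) by (intro window_point_le) (auto simp: b_def)
  moreover have "sqrt e \<le> Pdist b z"
    using assms z \<delta> by (auto simp: Pdist_def b_def)
  then have "sqrt e powr (max 0 (hom \<kappa> a)) \<le> Pdist b z powr (max 0 (hom \<kappa> a))"
    using assms(2) by (intro powr_mono2) auto
  then have "sqrt e powr (max 0 (hom \<kappa> a)) * \<bar>U z $ a\<bar>
      \<le> Pdist b z powr (max 0 (hom \<kappa> a)) * \<bar>U z $ a\<bar>"
    by (rule mult_right_mono) simp
  ultimately have "sqrt e powr (max 0 (hom \<kappa> a)) * \<bar>U z $ a\<bar> \<le> \<Lambda>"
    by linarith
  then show ?thesis
    using assms(2) by (simp add: powr_minus field_simps)
qed

text \<open>Up to time \<open>s + \<delta>\<close>, a window starting at \<open>s\<close> carries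
  the very weight of the claim. At later times \<open>component_le\<close> with \<open>e\<close>
  equal to \<delta> applies, the weight being at most 1 by the cap in \<open>Pdist\<close>.\<close>

lemma global_point_le:
  assumes "z \<in> strip s (s + T)"
  shows "Pdist s z powr (max 0 (hom \<kappa> a)) * \<bar>U z $ a\<bar> \<le> \<Lambda> * sqrt (\<delta> / 2) powr (- (\<gamma> + 2))"
proof (cases "fst z - s \<le> \<delta>")
  case True
  then have "Pdist s z powr (max 0 (hom \<kappa> a)) * \<bar>U z $ a\<bar> \<le> \<Lambda>"
    using assms by (intro window_point_le) (auto simp: strip_def)
  then show ?thesis
    using \<delta> \<gamma> \<Lambda> by (intro le_mult_powr_neg) auto
next
  case False
  then have "\<bar>U z $ a\<bar> \<le> \<Lambda> * sqrt \<delta> powr (- max 0 (hom \<kappa> a))"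
    using \<delta> by (intro component_le[OF assms]) auto
  also have "\<dots> \<le> \<Lambda> * sqrt (\<delta> / 2) powr (- (\<gamma> + 2))"
    using \<delta> \<gamma> \<Lambda> hom_bounds(2)[OF \<kappa>, of a] by (intro mult_left_mono powr_neg_le_powr_neg) auto
  finally have le: "\<bar>U z $ a\<bar> \<le> \<Lambda> * sqrt (\<delta> / 2) powr (- (\<gamma> + 2))" .
  have "Pdist s z powr (max 0 (hom \<kappa> a)) \<le> 1"
    by (intro powr_le1) (auto simp: Pdist_def)
  from mult_mono[OF this le] show ?thesis by simp
qed

section \<open>Two-point bounds at short and at long range\<close>

lemma short_range_le:
  assumes "z \<in> strip s (s + T)" "w \<in> strip s (s + T)" "z \<noteq> w" "nearest_lifts z w"
    and "pdist z w \<le> Pdist2 s z w" "pdist z w \<le> sqrt (\<delta> / 2)"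
  shows "Pdist2 s z w powr \<gamma> * (\<bar>(U z - \<Gamma> z w (U w)) $ a\<bar> / pdist z w powr (\<gamma> - hom \<kappa> a))
    \<le> \<Lambda> * sqrt (\<delta> / 2) powr (- (\<gamma> + 2))"
    (is "_ * ?q \<le> _")
proof -
  let ?M = "max (fst z) (fst w)"
  have z: "s < fst z" "s < fst w" "?M \<le> s + T"
    using assms(1,2) by (auto simp: strip_def)
  show ?thesis
  proof (cases "?M - s \<le> \<delta>")
    \<comment> \<open>A window starting at \<open>s\<close> contains both points, so the weight and
      the admissibility condition are the given ones.\<close>
    case True
    then have "Pdist2 s z w powr \<gamma> * ?q \<le> \<Lambda>"
      using z assms(3-5) by (intro window_two_point_le) auto
    then show ?thesis
      using \<delta> \<gamma> \<Lambda> by (intro le_mult_powr_neg) auto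
  next
    case False
    have "sqrt \<bar>fst z - fst w\<bar> \<le> sqrt (\<delta> / 2)"
      using assms(6) by (simp add: pdist_def)
    then have near: "\<bar>fst z - fst w\<bar> \<le> \<delta> / 2"
      by simp
    \<comment> \<open>The window of length \<delta> ending at the later point starts at
      \<open>?M - \<delta>\<close>. One point lies \<delta> after this start, the other at least
      \<delta> minus the time gap; hence the half in the threshold.\<close>
    then have "\<delta> / 2 \<le> \<bar>fst z - (?M - \<delta>)\<bar>" "\<delta> / 2 \<le> \<bar>fst w - (?M - \<delta>)\<bar>"
      by linarith+
    then have low: "sqrt (\<delta> / 2) \<le> Pdist2 (?M - \<delta>) z w"
      using \<delta> by (simp add: Pdist2_def Pdist_def)
    have "?M - \<delta> < fst z" "?M - \<delta> < fst w"
      using near \<delta>(1) by linarith+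
    \<comment> \<open>The pair is admissible for the new window because \<open>pdist z w\<close> is
      at most \<open>sqrt (\<delta> / 2)\<close>, which is at most its distance to the new
      start.\<close>
    then have "Pdist2 (?M - \<delta>) z w powr \<gamma> * ?q \<le> \<Lambda>"
      using z False low assms(3,4,6) by (intro window_two_point_le) auto
    moreover have "sqrt (\<delta> / 2) powr \<gamma> * ?q \<le> Pdist2 (?M - \<delta>) z w powr \<gamma> * ?q"
      using low \<delta> \<gamma> by (intro mult_right_mono powr_mono2) auto
    ultimately have "sqrt (\<delta> / 2) powr \<gamma> * ?q \<le> \<Lambda>"
      by linarith
    then have "?q \<le> \<Lambda> * sqrt (\<delta> / 2) powr (- \<gamma>)"
      using \<delta> by (simp add: powr_minus field_simps)
    also have "\<dots> \<le> \<Lambda> * sqrt (\<delta> / 2) powr (- (\<gamma> + 2))"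
      using \<delta> \<gamma> \<Lambda> by (intro mult_left_mono powr_neg_le_powr_neg) auto
    finally have le: "?q \<le> \<Lambda> * sqrt (\<delta> / 2) powr (- (\<gamma> + 2))" .
    have "Pdist2 s z w powr \<gamma> \<le> 1"
      using \<gamma> by (intro powr_le1) (auto simp: Pdist2_def Pdist_def)
    from mult_mono[OF this le] show ?thesis by simp
  qed
qed

text \<open>\<open>U z\<close> and the reexpanded \<open>U w\<close> are bounded separately. The
  constant counts one term for \<open>U z\<close> and one for each symbol in the expansion of
  \<open>U w\<close>.\<close>

lemma long_range_le:
  assumes "is_model \<kappa> \<P> \<Gamma>" "Gamma_norm \<kappa> \<Gamma> (closed_strip s (s + T)) = ennreal G" "1 \<le> G"
    and "z \<in> strip s (s + T)" "w \<in> strip s (s + T)" "z \<noteq> w" "nearest_lifts z w"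
    and "pdist z w \<le> Pdist2 s z w" "sqrt (\<delta> / 2) < pdist z w"
  shows "Pdist2 s z w powr \<gamma> * (\<bar>(U z - \<Gamma> z w (U w)) $ a\<bar> / pdist z w powr (\<gamma> - hom \<kappa> a))
    \<le> (1 + real CARD('n symbol)) * G * (\<Lambda> * sqrt (\<delta> / 2) powr (- (\<gamma> + 2)))"
    (is "_ * ?q \<le> _")
proof -
  let ?e = "sqrt (\<delta> / 2)" and ?d = "pdist z w"
  let ?B = "\<Lambda> * ?e powr (- (\<gamma> + 2))"
  have e: "0 < ?e" "?e \<le> 1" and d: "?e < ?d" "0 < ?d"
    using \<delta> assms(9) by auto (meson less_trans real_sqrt_gt_zero half_gt_zero)
  have B: "0 \<le> ?B" using \<Lambda> by simp
  have zs: "s < fst z" "s < fst w"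
    using assms(4,5) by (auto simp: strip_def)
  \<comment> \<open>The points are at most as far from each other as from the initial time, so
    points far apart are also late.\<close>
  have far: "\<delta> / 2 \<le> fst v - s" if "v = z \<or> v = w" for v
  proof -
    have "?e \<le> sqrt \<bar>fst v - s\<bar>"
      using that assms(8,9) by (auto simp: Pdist2_def Pdist_def simp del: real_sqrt_le_iff)
    then show ?thesis
      using that zs by auto
  qed
  have weighted: "\<bar>U v $ b\<bar> * ?d powr (hom \<kappa> b - \<gamma>) \<le> ?B" if v: "v = z \<or> v = w" for v b
  proof -
    have "\<bar>U v $ b\<bar> \<le> \<Lambda> * ?e powr (- max 0 (hom \<kappa> b))"
      using far[OF v] v assms(4,5) \<delta> by (intro component_le) auto
    moreover have "?d powr (hom \<kappa> b - \<gamma>) \<le> ?e powr (hom \<kappa> b - \<gamma>)"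
      using e d hom_less[of b] by (intro powr_mono2') auto
    ultimately have "\<bar>U v $ b\<bar> * ?d powr (hom \<kappa> b - \<gamma>)
        \<le> \<Lambda> * ?e powr (- max 0 (hom \<kappa> b)) * ?e powr (hom \<kappa> b - \<gamma>)"
      by (intro mult_mono) (use \<Lambda> in auto)
    also have "\<dots> = \<Lambda> * ?e powr (- max 0 (hom \<kappa> b) + (hom \<kappa> b - \<gamma>))"
      by (simp only: powr_add mult.assoc)
    \<comment> \<open>The origin of the exponent \<open>\<gamma> + 2\<close>: the sum of
      \<open>- max 0 (hom \<kappa> b)\<close> and \<open>hom \<kappa> b\<close> is the minimum of 0
      and the homogeneity, hence above -2.\<close>
    also have "\<dots> \<le> ?B"
      using e \<Lambda> hom_bounds(1)[OF \<kappa>, of b] by (intro mult_left_mono powr_mono') auto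
    finally show ?thesis .
  qed
  have closed: "z \<in> closed_strip s (s + T)" "w \<in> closed_strip s (s + T)"
    using assms(4,5) by (auto simp: strip_def closed_strip_def)
  have "\<bar>\<Gamma> z w (U w) $ a\<bar> * ?d powr (hom \<kappa> a - \<gamma>)
      \<le> (\<Sum>b\<in>UNIV. \<bar>U w $ b\<bar> * \<bar>\<Gamma> z w (sym b) $ a\<bar>) * ?d powr (hom \<kappa> a - \<gamma>)"
    unfolding model_Gamma_component[OF assms(1), of z w "U w" a]
    by (intro mult_right_mono order_trans[OF sum_abs]) (auto simp: abs_mult)
  also have "\<dots> = (\<Sum>b\<in>UNIV. \<bar>U w $ b\<bar> * \<bar>\<Gamma> z w (sym b) $ a\<bar> * ?d powr (hom \<kappa> a - \<gamma>))"
    by (simp add: sum_distrib_right)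
  also have "\<dots> \<le> (\<Sum>b\<in>(UNIV :: 'n symbol set). G * ?B)"
  proof (rule sum_mono)
    fix b :: "'n symbol"
    have "\<bar>U w $ b\<bar> * \<bar>\<Gamma> z w (sym b) $ a\<bar> * ?d powr (hom \<kappa> a - \<gamma>)
        \<le> \<bar>U w $ b\<bar> * (G * ?d powr (hom \<kappa> b - hom \<kappa> a)) * ?d powr (hom \<kappa> a - \<gamma>)"
      using model_Gamma_le[OF assms(1) \<kappa> assms(2,3) closed assms(6,7) d(2)]
      by (intro mult_right_mono mult_left_mono) auto
    also have "\<dots> = G * (\<bar>U w $ b\<bar> * (?d powr (hom \<kappa> b - hom \<kappa> a) * ?d powr (hom \<kappa> a - \<gamma>)))"
      by (simp only: mult_ac)
    \<comment> \<open>The homogeneity of \<open>a\<close> cancels, which leaves the weight under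
      which the component \<open>b\<close> of \<open>U w\<close> is already controlled.\<close>
    also have "\<dots> = G * (\<bar>U w $ b\<bar> * ?d powr (hom \<kappa> b - \<gamma>))"
      by (simp flip: powr_add)
    also have "\<dots> \<le> G * ?B"
      using weighted assms(3) by (intro mult_left_mono) auto
    finally show "\<bar>U w $ b\<bar> * \<bar>\<Gamma> z w (sym b) $ a\<bar> * ?d powr (hom \<kappa> a - \<gamma>) \<le> G * ?B" .
  qed
  finally have \<Gamma>U: "\<bar>\<Gamma> z w (U w) $ a\<bar> * ?d powr (hom \<kappa> a - \<gamma>) \<le> CARD('n symbol) * (G * ?B)"
    by simp
  have "?q = \<bar>(U z - \<Gamma> z w (U w)) $ a\<bar> * ?d powr (hom \<kappa> a - \<gamma>)"
    by (simp add: powr_diff divide_simps)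
  also have "\<dots> \<le> \<bar>U z $ a\<bar> * ?d powr (hom \<kappa> a - \<gamma>) + \<bar>\<Gamma> z w (U w) $ a\<bar> * ?d powr (hom \<kappa> a - \<gamma>)"
    unfolding distrib_right[symmetric] by (intro mult_right_mono) auto
  also have "\<dots> \<le> 1 * ?B + CARD('n symbol) * (G * ?B)"
    using weighted \<Gamma>U by (intro add_mono) auto
  also have "\<dots> \<le> G * ?B + CARD('n symbol) * (G * ?B)"
    using assms(3) B by (intro add_right_mono mult_right_mono) auto
  also have "\<dots> = (1 + real CARD('n symbol)) * G * ?B"
    by (simp add: algebra_simps)
  finally have le: "?q \<le> (1 + real CARD('n symbol)) * G * ?B" .
  have "Pdist2 s z w powr \<gamma> \<le> 1"
    using \<gamma> by (intro powr_le1) (auto simp: Pdist2_def Pdist_def)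
  from mult_mono[OF this le] show ?thesis by simp
qed

section \<open>The global bound\<close>

lemma md_norm_le:
  assumes "is_model \<kappa> \<P> \<Gamma>" "Gamma_norm \<kappa> \<Gamma> (closed_strip s (s + T)) = ennreal G" "1 \<le> G"
  shows "md_norm \<kappa> \<Gamma> \<gamma> 0 s (strip s (s + T)) (Rplus s U)
    \<le> ennreal ((2 + real CARD('n symbol)) * G * (\<Lambda> * sqrt (\<delta> / 2) powr (- (\<gamma> + 2))))"
proof -
  let ?B = "\<Lambda> * sqrt (\<delta> / 2) powr (- (\<gamma> + 2))"
  let ?A = "(1 + real CARD('n symbol)) * G * ?B"
  have B: "0 \<le> ?B" using \<Lambda> by simp
  have GB: "1 * ?B \<le> G * ?B"
    using assms(3) B by (rule mult_right_mono)
  have "1 * (G * ?B) \<le> (1 + real CARD('n symbol)) * (G * ?B)"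
    using GB B by (intro mult_right_mono) (simp, linarith)
  with GB have BA: "?B \<le> ?A"
    by (simp only: mult.assoc mult_1)
  have R: "Rplus s U z = U z" if "z \<in> strip s (s + T)" for z
    using that by (auto simp: Rplus_def strip_def)
  \<comment> \<open>\<open>?A\<close> dominates \<open>?B\<close> and so serves both ranges of the
    two-point supremum. The pointwise supremum adds one more \<open>?B\<close>, which turns the 1 in
    the constant into a 2.\<close>
  have "md_norm \<kappa> \<Gamma> \<gamma> 0 s (strip s (s + T)) (Rplus s U) \<le> ennreal (?A + ?B)"
  proof (rule md_norm_leI)
    fix a :: "'n symbol" and z w :: "'n spacetime"
    assume zw: "z \<in> strip s (s + T)" "w \<in> strip s (s + T)" "z \<noteq> w" "nearest_lifts z w"
      "pdist z w \<le> Pdist2 s z w"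
    show "Pdist2 s z w powr (\<gamma> - 0) * (\<bar>(Rplus s U z - \<Gamma> z w (Rplus s U w)) $ a\<bar>
        / pdist z w powr (\<gamma> - hom \<kappa> a)) \<le> ?A"
    proof (cases "pdist z w \<le> sqrt (\<delta> / 2)")
      case True
      from short_range_le[OF zw True, of a] BA show ?thesis
        unfolding R[OF zw(1)] R[OF zw(2)] diff_zero by linarith
    next
      case False
      then show ?thesis
        unfolding R[OF zw(1)] R[OF zw(2)] diff_zero
        by (intro long_range_le[OF assms zw]) simp
    qed
  next
    fix a :: "'n symbol" and z :: "'n spacetime"
    assume "z \<in> strip s (s + T)"
    then show "Pdist s z powr (max 0 (hom \<kappa> a - 0)) * \<bar>Rplus s U z $ a\<bar> \<le> ?B"
      using global_point_le[of z a] by (simp add: R)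
  qed (use B BA in linarith)+
  also have "\<dots> \<le> ennreal ((2 + real CARD('n symbol)) * G * ?B)"
    using GB by (intro ennreal_leI) (simp add: algebra_simps)
  finally show ?thesis .
qed

end

theorem lemma7:
  fixes \<kappa> \<gamma>1 :: real
  assumes "0 < \<kappa>" and "\<kappa> < 1 / 3" and "1 + \<kappa> < \<gamma>1" and "\<gamma>1 < 2 - 2 * \<kappa>"
  shows "\<exists>C > 0. \<forall>(\<P> :: 'n::finite pimap) (\<Gamma> :: 'n gammamap) (s :: real) (T :: real)
            (U :: 'n spacetime \<Rightarrow> 'n tspace) (\<delta>0 :: real) (\<Lambda> :: real).
     is_model \<kappa> \<P> \<Gamma> \<longrightarrow> 0 < T \<longrightarrow> T \<le> 1 \<longrightarrow>
     U \<in> modelled_distributions \<kappa> \<Gamma> \<gamma>1 s T \<longrightarrow>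
     0 < \<delta>0 \<longrightarrow> \<delta>0 \<le> T \<longrightarrow> 0 < \<Lambda> \<longrightarrow>
     (\<forall>b c. s \<le> b \<longrightarrow> b < c \<longrightarrow> c \<le> s + T \<longrightarrow> c - b \<le> \<delta>0 \<longrightarrow>
        md_norm \<kappa> \<Gamma> \<gamma>1 0 b (strip b c) (Rplus b U) \<le> ennreal \<Lambda>) \<longrightarrow>
     md_norm \<kappa> \<Gamma> \<gamma>1 0 s (strip s (s + T)) (Rplus s U)
       \<le> ennreal (C * (1 / \<delta>0) powr ((\<gamma>1 + 2) / 2))
          * (Gamma_norm \<kappa> \<Gamma> (closed_strip s (s + T)))\<^sup>2 * ennreal \<Lambda>"
proof (intro exI[of _ "(2 + real CARD('n symbol)) * 2 powr ((\<gamma>1 + 2) / 2)"] conjI allI impI)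
  let ?N = "2 + real CARD('n symbol)" and ?p = "(\<gamma>1 + 2) / 2"
  show "0 < ?N * 2 powr ?p" by simp
  fix \<P> :: "'n pimap" and \<Gamma> :: "'n gammamap" and s T :: real
    and U :: "'n spacetime \<Rightarrow> 'n tspace" and \<delta>0 \<Lambda> :: real
  assume model: "is_model \<kappa> \<P> \<Gamma>" and T: "0 < T" "T \<le> 1"
    and "U \<in> modelled_distributions \<kappa> \<Gamma> \<gamma>1 s T"
    and \<delta>0: "0 < \<delta>0" "\<delta>0 \<le> T" and \<Lambda>: "0 < \<Lambda>"
    and bound: "\<forall>b c. s \<le> b \<longrightarrow> b < c \<longrightarrow> c \<le> s + T \<longrightarrow> c - b \<le> \<delta>0 \<longrightarrow>
        md_norm \<kappa> \<Gamma> \<gamma>1 0 b (strip b c) (Rplus b U) \<le> ennreal \<Lambda>"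
  define G where "G = enn2real (Gamma_norm \<kappa> \<Gamma> (closed_strip s (s + T)))"
  have "Gamma_norm \<kappa> \<Gamma> (closed_strip s (s + T)) < \<infinity>"
    using model unfolding is_model_def by blast
  then have G: "Gamma_norm \<kappa> \<Gamma> (closed_strip s (s + T)) = ennreal G"
    by (simp add: G_def)
  \<comment> \<open>The summand 1 in \<open>Gamma_norm\<close> gives the lower bound.\<close>
  have "ennreal 1 \<le> ennreal G"
    unfolding G[symmetric] Gamma_norm_def by (simp add: add_increasing2)
  then have G1: "1 \<le> G"
    by (simp add: G_def ennreal_le_iff2)
  \<comment> \<open>The square root halves the exponent, and the half inside it produces the factor
    \<open>2 powr ?p\<close> of the constant.\<close>
  have "sqrt (\<delta>0 / 2) powr (- (\<gamma>1 + 2)) = (\<delta>0 / 2) powr (- ?p)"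
    using \<delta>0(1) by (simp add: powr_half_sqrt[symmetric] powr_powr minus_divide_left)
  also have "\<dots> = 2 powr ?p * (1 / \<delta>0) powr ?p"
    using \<delta>0(1) by (simp add: powr_minus powr_divide)
  finally have powers: "sqrt (\<delta>0 / 2) powr (- (\<gamma>1 + 2)) = 2 powr ?p * (1 / \<delta>0) powr ?p" .
  have "md_norm \<kappa> \<Gamma> \<gamma>1 0 s (strip s (s + T)) (Rplus s U)
    \<le> ennreal (?N * G * (\<Lambda> * sqrt (\<delta>0 / 2) powr (- (\<gamma>1 + 2))))"
    using md_norm_le[of \<kappa> \<gamma>1 \<delta>0 T \<Lambda> s \<Gamma> U \<P> G] assms T \<delta>0 \<Lambda> bound model G G1 by simp
  \<comment> \<open>The estimate so far is linear in \<open>G\<close>; \<open>1 \<le> G\<close>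
    allows passing to the square.\<close>
  also have "\<dots> \<le> ennreal (?N * G\<^sup>2 * (\<Lambda> * sqrt (\<delta>0 / 2) powr (- (\<gamma>1 + 2))))"
    using G1 \<Lambda> by (intro ennreal_leI mult_right_mono mult_left_mono) (auto simp: power2_eq_square)
  also have "?N * G\<^sup>2 * (\<Lambda> * sqrt (\<delta>0 / 2) powr (- (\<gamma>1 + 2)))
      = ?N * 2 powr ?p * (1 / \<delta>0) powr ?p * G\<^sup>2 * \<Lambda>"
    unfolding powers by (simp only: mult_ac)
  also have "ennreal \<dots> = ennreal (?N * 2 powr ?p * (1 / \<delta>0) powr ?p) * (ennreal G)\<^sup>2 * ennreal \<Lambda>"
    using G1 \<Lambda> by (simp add: ennreal_mult ennreal_power)
  finally show "md_norm \<kappa> \<Gamma> \<gamma>1 0 s (strip s (s + T)) (Rplus s U)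
       \<le> ennreal (?N * 2 powr ?p * (1 / \<delta>0) powr ?p)
          * (Gamma_norm \<kappa> \<Gamma> (closed_strip s (s + T)))\<^sup>2 * ennreal \<Lambda>"
    unfolding G .
qed

end
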